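(* Assume the set $S\times M$ of saddle points of $L$ is non-empty. Let $(x,\lambda):[0,+\infty)\to X\times Y$ be a solution of the Arrow--Hurwicz differential system (AH) and let $(\sigma,\omega):(0,+\infty)\to X\times Y$ be its Cesàro average, $$(\sigma(t),\omega(t))=\frac1t\int_0^t (x(\tau),\lambda(\tau))\,\mathrm d\tau .$$ Then, for any $(\xi,\eta)\in S\times M$, $$L(\sigma(t),\eta)-L(\xi,\omega(t))=\mathcal O\Big(\frac1t\Big)\quad\text{as } t\to+\infty .$$ Moreover, there exists $(\bar x,\bar\lambda)\in S\times M$ such that $(\sigma(t),\omega(t))\rightharpoonup(\bar x,\bar\lambda)$ weakly in $X\times Y$ as $t\to+\infty$.
   Context: $X$ and $Y$ are real Hilbert spaces with inner products $\langle\cdot,\cdot\rangle_X$, $\langle\cdot,\cdot\rangle_Y$ and norms $\|\cdot\|_X,\|\cdot\|_Y$; $X\times Y$ carries the product Hilbert structure, with norm $\|\cdot\|$. Standing assumptions: $f:X\to\mathbb R$ is convex and continuously differentiable; $\nabla f:X\to X$ is Lipschitz continuous on bounded sets; $A:X\to Y$ is linear and continuous with adjoint $A^*$; $b\in Y$. The Lagrangian is $L:X\times Y\to\mathbb R$, $L(x,\lambda)=f(x)+\langle\lambda,Ax-b\rangle_Y$. A saddle point of $L$ is a pair $(\bar x,\bar\lambda)\in X\times Y$ with $L(\bar x,\lambda)\le L(\bar x,\bar\lambda)\le L(x,\bar\lambda)$ for all $(x,\lambda)\in X\times Y$; the set of saddle points of $L$ is denoted by $S\times M\subset X\times Y$.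 The system (AH) is $$\dot x+\nabla f(x)+A^*\lambda=0_X,\qquad \dot\lambda+b-Ax=0_Y,$$ with initial data $(x(0),\lambda(0))=(x_0,\lambda_0)\in X\times Y$; a solution is a function $(x,\lambda)\in\mathcal C^1([0,+\infty);X\times Y)$ satisfying the system on $[0,+\infty)$ with these initial data. *)

theory Defs
  imports "HOL-Analysis.Analysis" "HOL-Library.Landau_Symbols"
begin

text \<open>
  A real Hilbert space is rendered as a type of sort \<open>{real_inner, banach}\<close>. Then
  \<open>'a \<times> 'b\<close> is again of this sort, with inner product
  \<open>(x, y) \<bullet> (x', y') = x \<bullet> x' + y \<bullet> y'\<close>.
\<close>

definition continuously_differentiable ::
    "('a::real_normed_vector \<Rightarrow> 'b::real_normed_vector) \<Rightarrow> bool" where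
  "continuously_differentiable f \<longleftrightarrow>
     (\<exists>f' :: 'a \<Rightarrow> 'a \<Rightarrow>\<^sub>L 'b.
        (\<forall>x. (f has_derivative blinfun_apply (f' x)) (at x)) \<and> continuous_on UNIV f')"

definition gradient :: "('a::real_inner \<Rightarrow> real) \<Rightarrow> 'a \<Rightarrow> 'a" where
  "gradient f x = (THE g. GDERIV f x :> g)"

definition Lagrangian ::
    "('a::real_inner \<Rightarrow> real) \<Rightarrow> ('a \<Rightarrow> 'b::real_inner) \<Rightarrow> 'b \<Rightarrow> 'a \<Rightarrow> 'b \<Rightarrow> real" where
  "Lagrangian f A b x l = f x + l \<bullet> (A x - b)"

definition saddle_points :: "('a \<Rightarrow> 'b \<Rightarrow> real) \<Rightarrow> ('a \<times> 'b) set" where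
  "saddle_points L =
     {(xb, lb). \<forall>x l. L xb l \<le> L xb lb \<and> L xb lb \<le> L x lb}"

text \<open>
  Only the values on \<open>[0, \<infinity>)\<close> matter: derivatives are taken within \<open>{0..}\<close>,
  hence are one-sided at \<open>0\<close>. The witnesses \<open>x'\<close> and \<open>l'\<close> are the derivatives
  of the two components, and their continuity expresses the class \<open>C\<^sup>1\<close>.
\<close>

definition AH_solution ::
    "('a::{real_inner, banach} \<Rightarrow> real) \<Rightarrow> ('a \<Rightarrow> 'b::{real_inner, banach}) \<Rightarrow> 'b \<Rightarrow> 'a \<Rightarrow> 'b \<Rightarrow>
     (real \<Rightarrow> 'a) \<Rightarrow> (real \<Rightarrow> 'b) \<Rightarrow> bool" where
  "AH_solution f A b x0 l0 x l \<longleftrightarrow>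
     (\<exists>x' l'. continuous_on {0..} x' \<and> continuous_on {0..} l' \<and>
        (\<forall>t\<ge>0. (x has_vector_derivative x' t) (at t within {0..}) \<and>
               (l has_vector_derivative l' t) (at t within {0..}) \<and>
               x' t + gradient f (x t) + adjoint A (l t) = 0 \<and>
               l' t + b - A (x t) = 0)) \<and>
     x 0 = x0 \<and> l 0 = l0"

definition weakly_tendsto ::
    "('t \<Rightarrow> 'a::real_normed_vector) \<Rightarrow> 'a \<Rightarrow> 't filter \<Rightarrow> bool" where
  "weakly_tendsto z l F \<longleftrightarrow>
     (\<forall>\<phi> :: 'a \<Rightarrow> real. bounded_linear \<phi> \<longrightarrow> ((\<lambda>t. \<phi> (z t)) \<longlongrightarrow> \<phi> l) F)"

end

theory Submission
  imports Defs
begin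

text \<open>
  Write \<open>z = (x, \<lambda>)\<close>, \<open>\<zeta> = (\<sigma>, \<omega>)\<close> and, for \<open>p = (p\<^sub>1, p\<^sub>2)\<close> and \<open>w = (u, v)\<close>,
  \<open>gap p w = L(p\<^sub>1, v) - L(u, p\<^sub>2)\<close>; then \<open>p\<close> is a saddle point iff \<open>gap p w \<le> 0\<close> for all \<open>w\<close>.
  Since \<open>gap\<close> is convex in \<open>p\<close>, the flow satisfies
  \<open>d/dt \<parallel>z - w\<parallel>\<^sup>2 / 2 \<le> - gap z w\<close>, and integrating gives
  \<open>gap (\<zeta> t) w \<le> \<parallel>z 0 - w\<parallel>\<^sup>2 / (2 t)\<close>. For a saddle point \<open>w\<close> the left-hand side is
  nonnegative, which is the rate; for arbitrary \<open>w\<close>, weak lower semicontinuity shows that every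
  weak cluster point of \<open>\<zeta>\<close> is a saddle point. Moreover \<open>\<parallel>z - p\<parallel>\<close> is nonincreasing
  for each saddle point \<open>p\<close>, so \<open>\<langle>z, p - q\<rangle>\<close> converges for any two saddle points, hence so
  does its average \<open>\<langle>\<zeta>, p - q\<rangle>\<close>; this leaves only one weak cluster point.
\<close>

section \<open>Riesz representation and gradients\<close>

text \<open>The representing vector is obtained as the minimiser of \<open>v \<mapsto> \<parallel>v\<parallel>\<^sup>2 / 2 - \<phi> v\<close>; minimising
  sequences are Cauchy by the parallelogram law.\<close>

lemma riesz_representation:
  fixes \<phi> :: "'a::{real_inner, banach} \<Rightarrow> real"
  assumes "bounded_linear \<phi>"
  obtains r where "\<And>h. \<phi> h = h \<bullet> r"
proof -
  interpret bounded_linear \<phi> by fact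
  define J where "J v = (v \<bullet> v) / 2 - \<phi> v" for v
  define m where "m = Inf (range J)"
  obtain K where K: "\<And>v. norm (\<phi> v) \<le> norm v * K"
    using bounded by auto
  have "J v \<ge> - K\<^sup>2 / 2" for v
  proof -
    have "\<phi> v \<le> norm v * K" using K[of v] by auto
    moreover have "(norm v - K)\<^sup>2 \<ge> 0" by simp
    ultimately show ?thesis
      unfolding J_def power2_norm_eq_inner[symmetric] by (simp add: power2_eq_square algebra_simps)
  qed
  then have bdd: "bdd_below (range J)" by (auto intro!: bdd_belowI2)
  have m_le: "m \<le> J v" for v
    unfolding m_def using bdd by (simp add: cINF_lower)
  have "\<exists>v. J v < m + 1 / real (Suc n)" for n
  proof -
    have "m < m + 1 / real (Suc n)" by simp
    then show ?thesis
      unfolding m_def using cInf_lessD[of "range J"] by blast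
  qed
  then obtain V where V: "\<And>n. J (V n) < m + 1 / real (Suc n)" by metis
  \<comment> \<open>The linear part of \<open>J\<close> cancels against its value at the midpoint of
    \<open>v\<close> and \<open>w\<close>, which is itself at least \<open>m\<close>.\<close>
  have par: "(norm (v - w))\<^sup>2 \<le> 4 * (J v - m) + 4 * (J w - m)" for v w
  proof -
    have "(norm (v - w))\<^sup>2 / 4 = J v + J w - 2 * J ((1/2) *\<^sub>R (v + w))"
      unfolding J_def power2_norm_eq_inner
      by (simp add: algebra_simps inner_commute add scaleR diff_divide_distrib add_divide_distrib)
    then show ?thesis using m_le[of "(1/2) *\<^sub>R (v + w)"] by simp
  qed
  have "Cauchy V"
  proof (rule metric_CauchyI)
    fix e :: real assume e: "e > 0"
    obtain N where N: "1 / real (Suc N) < e\<^sup>2 / 8"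
      using e by (metis nat_approx_posE zero_less_power divide_pos_pos zero_less_numeral)
    have "dist (V i) (V j) < e" if "N \<le> i" "N \<le> j" for i j
    proof -
      have small: "J (V k) - m < e\<^sup>2 / 8" if "N \<le> k" for k
      proof -
        have "1 / real (Suc k) \<le> 1 / real (Suc N)" using that by (simp add: frac_le)
        then show ?thesis using V[of k] N by linarith
      qed
      have "(norm (V i - V j))\<^sup>2 \<le> 4 * (J (V i) - m) + 4 * (J (V j) - m)" by (rule par)
      also have "\<dots> < 4 * (e\<^sup>2 / 8) + 4 * (e\<^sup>2 / 8)"
        by (intro add_strict_mono mult_strict_left_mono small that) simp_all
      finally have "(norm (V i - V j))\<^sup>2 < e\<^sup>2" by simp
      then show ?thesis using e by (simp add: dist_norm power_less_imp_less_base)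
    qed
    then show "\<exists>M. \<forall>i\<ge>M. \<forall>j\<ge>M. dist (V i) (V j) < e" by blast
  qed
  then obtain r where r: "V \<longlonglongrightarrow> r"
    using convergent_eq_Cauchy[of V] by blast
  have "(\<lambda>n. J (V n)) \<longlonglongrightarrow> J r"
    unfolding J_def by (intro tendsto_intros tendsto r) simp
  moreover have "(\<lambda>n. m + 1 / real (Suc n)) \<longlonglongrightarrow> m + 0"
    by (intro tendsto_add tendsto_const LIMSEQ_Suc[OF lim_1_over_n])
  ultimately have "J r \<le> m + 0"
    using V by (intro LIMSEQ_le) (auto intro: less_imp_le)
  then have min: "J r \<le> J v" for v using m_le[of v] by simp
  have "\<phi> h = h \<bullet> r" for h
  proof -
    define d where "d = r \<bullet> h - \<phi> h"
    have quad: "0 \<le> s * d + s\<^sup>2 * (h \<bullet> h) / 2" for s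
      using min[of "r + s *\<^sub>R h"]
      by (simp add: J_def d_def add scaleR algebra_simps inner_commute power2_eq_square)
    have "d = 0"
    proof (cases "h = 0")
      case True then show ?thesis by (simp add: d_def zero)
    next
      case False
      then have "h \<bullet> h > 0" by simp
      \<comment> \<open>This \<open>s\<close> minimises the quadratic in \<open>s\<close>; its
        minimum value \<open>- d^2 / (2 * (h \<bullet> h))\<close> can be nonnegative only if
        \<open>d = 0\<close>.\<close>
      with quad[of "- d / (h \<bullet> h)"] have "0 \<le> - d\<^sup>2 / 2"
        by (simp add: field_simps power2_eq_square)
      then show ?thesis by simp
    qed
    then show ?thesis by (simp add: d_def inner_commute)
  qed
  then show ?thesis by (rule that)
qed

text \<open>\<open>adjoint\<close> is defined by choice; the library's \<open>adjoint_works\<close> covers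
  Euclidean spaces only.\<close>

lemma inner_adjoint:
  fixes A :: "'a::{real_inner, banach} \<Rightarrow> 'b::real_inner"
  assumes "bounded_linear A"
  shows "x \<bullet> adjoint A y = A x \<bullet> y"
proof -
  have "\<exists>g. \<forall>x. A x \<bullet> y = x \<bullet> g" for y
    using riesz_representation[OF bounded_linear_compose[OF bounded_linear_inner_left assms]]
    by metis
  then obtain g where "\<forall>x y. A x \<bullet> y = x \<bullet> g y" by metis
  then show ?thesis using adjoint_unique by metis
qed

text \<open>Discharges the definite description in \<open>gradient\<close>: Riesz gives existence of
  the vector, uniqueness of the derivative its uniqueness.\<close>

lemma GDERIV_gradient:
  fixes f :: "'a::{real_inner, banach} \<Rightarrow> real"
  assumes "f differentiable at x"
  shows "GDERIV f x :> gradient f x"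
proof -
  obtain f' where f': "(f has_derivative f') (at x)"
    using assms by (auto simp: differentiable_def)
  obtain g where "\<And>h. f' h = h \<bullet> g"
    using riesz_representation[OF has_derivative_bounded_linear[OF f']] by blast
  then have g: "GDERIV f x :> g"
    using f' unfolding gderiv_def by (metis ext)
  have "(THE g. GDERIV f x :> g) = g"
  proof (rule the_equality[of "\<lambda>g. GDERIV f x :> g", OF g])
    fix g' assume "GDERIV f x :> g'"
    then have "(\<lambda>h. h \<bullet> g') = (\<lambda>h. h \<bullet> g)"
      using g has_derivative_unique unfolding gderiv_def by blast
    then show "g' = g" by (metis vector_eq_rdot inner_commute)
  qed
  then show ?thesis using g by (simp add: gradient_def)
qed

text \<open>Restriction to the line through \<open>x\<close> and \<open>y\<close> reduces this to
  the tangent inequality for convex functions of one real variable.\<close>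

lemma convex_on_above_gradient:
  fixes f :: "'a::real_inner \<Rightarrow> real"
  assumes "convex_on UNIV f" "GDERIV f x :> g"
  shows "f x + (y - x) \<bullet> g \<le> f y"
proof -
  define p where "p s = x + s *\<^sub>R (y - x)" for s
  have "convex_on UNIV (f \<circ> p)"
  proof (rule convex_onI)
    fix t u v :: real assume t: "0 < t" "t < 1"
    have "p ((1 - t) *\<^sub>R u + t *\<^sub>R v) = (1 - t) *\<^sub>R p u + t *\<^sub>R p v"
      unfolding p_def by (simp add: algebra_simps)
    then show "(f \<circ> p) ((1 - t) *\<^sub>R u + t *\<^sub>R v) \<le> (1 - t) * (f \<circ> p) u + t * (f \<circ> p) v"
      using convex_onD[OF assms(1), of t "p u" "p v"] t by simp
  qed simp
  moreover have "((f \<circ> p) has_real_derivative (y - x) \<bullet> g) (at 0)"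
  proof -
    have "(p has_derivative (\<lambda>s. s *\<^sub>R (y - x))) (at 0)"
      unfolding p_def by (auto intro!: derivative_eq_intros)
    moreover have "(f has_derivative (\<lambda>h. h \<bullet> g)) (at (p 0))"
      using assms(2) by (simp add: gderiv_def p_def)
    ultimately have "((f \<circ> p) has_derivative (\<lambda>h. h \<bullet> g) \<circ> (\<lambda>s. s *\<^sub>R (y - x))) (at 0)"
      by (rule diff_chain_at)
    moreover have "(\<lambda>h. h \<bullet> g) \<circ> (\<lambda>s. s *\<^sub>R (y - x)) = (*) ((y - x) \<bullet> g)"
      by (simp add: fun_eq_iff)
    ultimately show ?thesis by (simp add: has_field_derivative_def)
  qed
  ultimately have "(y - x) \<bullet> g * (1 - 0) \<le> (f \<circ> p) 1 - (f \<circ> p) 0"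
    by (intro convex_on_imp_above_tangent[where A = UNIV and c = 0 and x = 1]) (auto simp del: o_apply)
  then show ?thesis by (simp add: p_def)
qed

section \<open>Limits at infinity and weak convergence\<close>

lemma antimono_bounded_below_tendsto_at_top:
  fixes g :: "real \<Rightarrow> real"
  assumes "\<And>s t. \<lbrakk>a \<le> s; s \<le> t\<rbrakk> \<Longrightarrow> g t \<le> g s" and "\<And>t. a \<le> t \<Longrightarrow> c \<le> g t"
  obtains L where "(g \<longlongrightarrow> L) at_top"
proof -
  have bdd: "bdd_below (g ` {a..})" using assms(2) by (auto intro!: bdd_belowI2)
  have "(g \<longlongrightarrow> (INF t\<in>{a..}. g t)) at_top"
  proof (rule decreasing_tendsto)
    show "\<forall>\<^sub>F t in at_top. (INF t\<in>{a..}. g t) \<le> g t"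
      using eventually_ge_at_top[of a] by eventually_elim (simp add: cINF_lower bdd)
    fix y assume "(INF t\<in>{a..}. g t) < y"
    then obtain s where s: "a \<le> s" "g s < y"
      using cINF_less_iff[OF _ bdd, of y] by auto
    show "\<forall>\<^sub>F t in at_top. g t < y"
      using eventually_ge_at_top[of s] by eventually_elim (use s assms(1) in fastforce)
  qed
  then show ?thesis by (rule that)
qed

text \<open>L'Hopital's rule: the integral has derivative \<open>g\<close>, the denominator has
  derivative 1 and tends to infinity.\<close>

lemma cesaro_tendsto_at_top:
  fixes g :: "real \<Rightarrow> real"
  assumes cont: "continuous_on {a..} g" and lim: "(g \<longlongrightarrow> L) at_top"
  shows "((\<lambda>t. integral {a..t} g / t) \<longlongrightarrow> L) at_top"
proof (rule lhospital_at_top_at_top[where f' = g and g' = "\<lambda>_. 1"])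
  show "\<forall>\<^sub>F t in at_top. DERIV (\<lambda>t. integral {a..t} g) t :> g t"
    using eventually_gt_at_top[of a]
  proof eventually_elim
    case (elim t)
    \<comment> \<open>The right end \<open>t + 1\<close> puts \<open>t\<close> in the interior, so
      the derivative within the interval is a two-sided one.\<close>
    have "((\<lambda>t. integral {a..t} g) has_real_derivative g t) (at t within {a..t + 1})"
      using elim by (intro integral_has_real_derivative continuous_on_subset[OF cont]) auto
    then show ?case using elim by (simp add: at_within_Icc_at)
  qed
qed (use lim in \<open>auto simp: filterlim_ident intro!: always_eventually\<close>)

text \<open>Each \<open>z t\<close> is viewed as the function \<open>h \<mapsto> \<langle>z t, h\<rangle>\<close> in a product of compact intervals,
  so that Tychonoff's theorem applies; \<open>G\<close> plays the role of a subnet.\<close>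

lemma bounded_weak_cluster_point:
  fixes z :: "'t \<Rightarrow> 'a::{real_inner, banach}"
  assumes "F \<noteq> bot" and bnd: "\<forall>\<^sub>F t in F. norm (z t) \<le> M"
  obtains G p where "G \<noteq> bot" "G \<le> F" "weakly_tendsto z p G"
proof -
  define \<Phi> where "\<Phi> t = (\<lambda>h. z t \<bullet> h)" for t
  define K where "K = (\<Pi>\<^sub>E h\<in>(UNIV::'a set). {- (M * norm h)..M * norm h})"
  have "compact K"
    unfolding compactin_euclidean_iff[symmetric] euclidean_product_topology[symmetric] K_def
    by (simp add: compactin_PiE)
  moreover have "filtermap \<Phi> F \<noteq> bot"
    using assms(1) by (simp add: filtermap_bot_iff)
  moreover have "\<forall>\<^sub>F g in filtermap \<Phi> F. g \<in> K"
    unfolding eventually_filtermap using bnd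
  proof eventually_elim
    case (elim t)
    have "\<bar>z t \<bullet> h\<bar> \<le> M * norm h" for h
      using Cauchy_Schwarz_ineq2[of "z t" h] mult_right_mono[OF elim norm_ge_zero[of h]] by linarith
    then show ?case
      by (auto simp: K_def \<Phi>_def abs_le_iff minus_le_iff)
  qed
  ultimately obtain g where "g \<in> K" and g: "inf (nhds g) (filtermap \<Phi> F) \<noteq> bot"
    unfolding compact_filter by blast
  \<comment> \<open>Restricting \<open>F\<close> to preimages of neighbourhoods of \<open>g\<close>
    makes \<open>\<Phi>\<close> converge to \<open>g\<close>; \<open>G\<close> is proper because
    \<open>g\<close> is a cluster point.\<close>
  define G where "G = inf F (filtercomap \<Phi> (nhds g))"
  have "G \<noteq> bot"
  proof
    assume "G = bot"
    then obtain P Q where "eventually P F" "eventually Q (nhds g)" and PQ: "\<And>t. P t \<Longrightarrow> Q (\<Phi> t) \<Longrightarrow> False"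
      unfolding G_def trivial_limit_def eventually_inf eventually_filtercomap by blast
    from this(1) have "\<forall>\<^sub>F g in filtermap \<Phi> F. \<not> Q g"
      unfolding eventually_filtermap by (rule eventually_mono) (use PQ in blast)
    with \<open>eventually Q (nhds g)\<close> have "\<forall>\<^sub>F g in inf (nhds g) (filtermap \<Phi> F). False"
      unfolding eventually_inf by blast
    then show False using g by (simp add: trivial_limit_def)
  qed
  have "(\<Phi> \<longlongrightarrow> g) G"
    unfolding G_def filterlim_def
    by (meson filtermap_filtercomap filtermap_mono inf_le2 order_trans)
  then have lim: "((\<lambda>t. z t \<bullet> h) \<longlongrightarrow> g h) G" for h
    using continuous_on_tendsto_compose[OF continuous_on_product_coordinates[of h]]
    by (fastforce simp: \<Phi>_def)
  \<comment> \<open>Linearity survives pointwise limits and the norm bound is membership in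
    \<open>K\<close>, so Riesz turns \<open>g\<close> into a vector.\<close>
  have "bounded_linear g"
  proof (rule bounded_linear_intro)
    show "g (u + v) = g u + g v" for u v
      using lim[of "u + v"] tendsto_add[OF lim[of u] lim[of v]] \<open>G \<noteq> bot\<close>
      by (auto simp: inner_add_right intro: tendsto_unique)
    show "g (c *\<^sub>R u) = c *\<^sub>R g u" for c u
      using lim[of "c *\<^sub>R u"] tendsto_mult_left[OF lim[of u], of c] \<open>G \<noteq> bot\<close>
      by (auto intro: tendsto_unique)
    show "norm (g u) \<le> norm u * M" for u
      using \<open>g \<in> K\<close> by (auto simp: K_def PiE_iff abs_le_iff minus_le_iff mult.commute)
  qed
  then obtain p where p: "\<And>h. g h = h \<bullet> p"
    using riesz_representation by blast
  have "weakly_tendsto z p G"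
    unfolding weakly_tendsto_def
  proof (intro allI impI)
    fix \<phi> :: "'a \<Rightarrow> real" assume "bounded_linear \<phi>"
    then obtain r where "\<And>h. \<phi> h = h \<bullet> r" using riesz_representation by blast
    then show "((\<lambda>t. \<phi> (z t)) \<longlongrightarrow> \<phi> p) G"
      using lim[of r] p[of r] by (simp add: inner_commute)
  qed
  then show ?thesis using that \<open>G \<noteq> bot\<close> by (simp add: G_def)
qed

lemma weakly_tendsto_inner:
  "weakly_tendsto z p F \<Longrightarrow> ((\<lambda>t. z t \<bullet> h) \<longlongrightarrow> p \<bullet> h) F"
  unfolding weakly_tendsto_def using bounded_linear_inner_left by blast

text \<open>Along filters for two cluster points \<open>p\<close> and \<open>q\<close>, the
  convergent product has limits \<open>p \<bullet> (p - q)\<close> and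
  \<open>q \<bullet> (p - q)\<close>; their equality forces \<open>p = q\<close>. Weak compactness
  then upgrades uniqueness to convergence.\<close>

lemma opial:
  fixes z :: "'t \<Rightarrow> 'a::{real_inner, banach}"
  assumes F: "F \<noteq> bot" and bnd: "\<forall>\<^sub>F t in F. norm (z t) \<le> M"
    and cluster: "\<And>G p. \<lbrakk>G \<noteq> bot; G \<le> F; weakly_tendsto z p G\<rbrakk> \<Longrightarrow> p \<in> S"
    and conv: "\<And>p q. \<lbrakk>p \<in> S; q \<in> S\<rbrakk> \<Longrightarrow> \<exists>c. ((\<lambda>t. z t \<bullet> (p - q)) \<longlongrightarrow> c) F"
  obtains p where "p \<in> S" "weakly_tendsto z p F"
proof -
  obtain G p where G: "G \<noteq> bot" "G \<le> F" and p: "weakly_tendsto z p G"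
    using bounded_weak_cluster_point[OF F bnd] by blast
  have "p \<in> S" using cluster G p by blast
  moreover have "weakly_tendsto z p F"
    unfolding weakly_tendsto_def
  proof (intro allI impI, rule ccontr)
    fix \<phi> :: "'a \<Rightarrow> real"
    assume lin: "bounded_linear \<phi>" and "\<not> ((\<lambda>t. \<phi> (z t)) \<longlongrightarrow> \<phi> p) F"
    then obtain e where "e > 0" and e: "\<not> (\<forall>\<^sub>F t in F. dist (\<phi> (z t)) (\<phi> p) < e)"
      by (auto simp: tendsto_iff)
    \<comment> \<open>Failure of convergence makes this restriction proper. A cluster point along it
      must again be \<open>p\<close>, although \<open>\<phi> (z t)\<close> stays at distance at
      least \<open>e\<close> from \<open>\<phi> p\<close>.\<close>
    define F' where "F' = inf F (principal {t. \<not> dist (\<phi> (z t)) (\<phi> p) < e})"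
    have "F' \<noteq> bot"
      using e by (simp add: F'_def trivial_limit_def eventually_inf_principal)
    moreover have "F' \<le> F" by (simp add: F'_def)
    ultimately obtain H q where H: "H \<noteq> bot" "H \<le> F'" and q: "weakly_tendsto z q H"
      using bounded_weak_cluster_point[of F' z M] bnd filter_leD by metis
    have "H \<le> F" using H \<open>F' \<le> F\<close> by simp
    then have "q \<in> S" using cluster H q by blast
    then obtain c where c: "((\<lambda>t. z t \<bullet> (p - q)) \<longlongrightarrow> c) F" using conv \<open>p \<in> S\<close> by blast
    have "p \<bullet> (p - q) = c" "q \<bullet> (p - q) = c"
      using tendsto_unique[OF G(1) weakly_tendsto_inner[OF p] tendsto_mono[OF G(2) c]]
        tendsto_unique[OF H(1) weakly_tendsto_inner[OF q] tendsto_mono[OF \<open>H \<le> F\<close> c]] by auto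
    then have "(p - q) \<bullet> (p - q) = 0" by (simp add: inner_diff_left)
    then have "q = p" by simp
    then have "((\<lambda>t. \<phi> (z t)) \<longlongrightarrow> \<phi> p) H"
      using q lin by (simp add: weakly_tendsto_def)
    then have "\<forall>\<^sub>F t in H. dist (\<phi> (z t)) (\<phi> p) < e" using \<open>e > 0\<close> by (rule tendstoD)
    moreover have "\<forall>\<^sub>F t in H. \<not> dist (\<phi> (z t)) (\<phi> p) < e"
      using H(2) by (rule filter_leD) (simp add: F'_def eventually_inf_principal)
    ultimately have "\<forall>\<^sub>F t in H. False" by eventually_elim simp
    then show False using H(1) by (simp add: trivial_limit_def)
  qed
  ultimately show ?thesis by (rule that)
qed

section \<open>The gap function and the flow\<close>

definition lagrangian_gap ::
    "('a::real_inner \<Rightarrow> real) \<Rightarrow> ('a \<Rightarrow> 'b::real_inner) \<Rightarrow> 'b \<Rightarrow> 'a \<times> 'b \<Rightarrow> 'a \<times> 'b \<Rightarrow> real" where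
  "lagrangian_gap f A b p w = Lagrangian f A b (fst p) (snd w) - Lagrangian f A b (fst w) (snd p)"

lemma lagrangian_gap_self [simp]: "lagrangian_gap f A b p p = 0"
  by (simp add: lagrangian_gap_def)

lemma lagrangian_gap_swap: "lagrangian_gap f A b w p = - lagrangian_gap f A b p w"
  by (simp add: lagrangian_gap_def)

text \<open>The two saddle inequalities chain through \<open>Lagrangian f A b p1 p2\<close>; testing
  with a \<open>w\<close> that shares one component with \<open>p\<close> separates them
  again.\<close>

lemma saddle_points_iff_gap:
  "p \<in> saddle_points (Lagrangian f A b) \<longleftrightarrow> (\<forall>w. lagrangian_gap f A b p w \<le> 0)"
proof -
  obtain p1 p2 where p: "p = (p1, p2)" by (cases p)
  show ?thesis
  proof
    assume "p \<in> saddle_points (Lagrangian f A b)"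
    then show "\<forall>w. lagrangian_gap f A b p w \<le> 0"
      unfolding saddle_points_def lagrangian_gap_def p by (auto intro: order_trans)
  next
    assume gap: "\<forall>w. lagrangian_gap f A b p w \<le> 0"
    have "Lagrangian f A b p1 v \<le> Lagrangian f A b p1 p2" for v
      using gap[rule_format, of "(p1, v)"] by (simp add: lagrangian_gap_def p)
    moreover have "Lagrangian f A b p1 p2 \<le> Lagrangian f A b u p2" for u
      using gap[rule_format, of "(u, p2)"] by (simp add: lagrangian_gap_def p)
    ultimately show "p \<in> saddle_points (Lagrangian f A b)"
      by (simp add: saddle_points_def p)
  qed
qed

lemma lagrangian_gap_saddle_point_nonneg:
  "p \<in> saddle_points (Lagrangian f A b) \<Longrightarrow> 0 \<le> lagrangian_gap f A b w p"
  unfolding saddle_points_iff_gap lagrangian_gap_swap[of f A b w p] by (simp del: split_paired_All)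

text \<open>In its first argument the gap is \<open>f\<close> plus an affine function, and the
  vector paired with \<open>q - p\<close> is its gradient at \<open>p\<close>. For
  \<open>w = p\<close> that vector is minus the right-hand side of (AH).\<close>

lemma lagrangian_gap_above_tangent:
  fixes f :: "'a::{real_inner, banach} \<Rightarrow> real" and A :: "'a \<Rightarrow> 'b::real_inner"
  assumes "convex_on UNIV f" "f differentiable at (fst p)" and A: "bounded_linear A"
  shows "lagrangian_gap f A b p w
      + (q - p) \<bullet> (gradient f (fst p) + adjoint A (snd w), b - A (fst w))
    \<le> lagrangian_gap f A b q w"
proof -
  interpret A: bounded_linear A by fact
  have "f (fst p) + (fst q - fst p) \<bullet> gradient f (fst p) \<le> f (fst q)"
    using assms by (intro convex_on_above_gradient GDERIV_gradient)
  then show ?thesis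
    by (simp add: lagrangian_gap_def Lagrangian_def inner_prod_def inner_adjoint[OF A] A.diff
        inner_add_right inner_diff_left inner_diff_right inner_commute)
qed

section \<open>Energy estimates and averages along the flow\<close>

locale AH_flow =
  fixes f :: "'a::{real_inner, banach} \<Rightarrow> real"
    and A :: "'a \<Rightarrow> 'b::{real_inner, banach}" and b :: 'b
    and z :: "real \<Rightarrow> 'a \<times> 'b"
  assumes convex: "convex_on UNIV f"
    and differentiable: "\<And>u. f differentiable at u"
    and linear: "bounded_linear A"
    and flow: "\<And>t. 0 \<le> t \<Longrightarrow>
      (z has_vector_derivative
        - (gradient f (fst (z t)) + adjoint A (snd (z t)), b - A (fst (z t)))) (at t within {0..})"
begin

abbreviation gap where "gap \<equiv> lagrangian_gap f A b"

definition cesaro :: "real \<Rightarrow> 'a \<times> 'b" where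
  "cesaro t = (1 / t) *\<^sub>R integral {0..t} z"

definition energy :: "'a \<times> 'b \<Rightarrow> real \<Rightarrow> real" where
  "energy w t = (z t - w) \<bullet> (z t - w) / 2"

text \<open>The time derivative of \<open>energy w\<close> along the flow; the minus sign of the
  field is absorbed into \<open>w - z t\<close>, the form of the tangent inequality.\<close>

definition energy' :: "'a \<times> 'b \<Rightarrow> real \<Rightarrow> real" where
  "energy' w t =
    (w - z t) \<bullet> (gradient f (fst (z t)) + adjoint A (snd (z t)), b - A (fst (z t)))"

lemma continuous_on_z: "continuous_on {0..} z"
  using flow has_vector_derivative_continuous
  by (fastforce simp: continuous_on_eq_continuous_within)

lemma has_integral_cesaro:
  assumes "0 < t"
  shows "(z has_integral t *\<^sub>R cesaro t) {0..t}"
proof -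
  have "z integrable_on {0..t}"
    by (intro integrable_continuous_real continuous_on_subset[OF continuous_on_z]) auto
  then show ?thesis
    using assms by (simp add: cesaro_def has_integral_integrable_integral)
qed

lemma has_integral_inner_cesaro:
  assumes "0 < t"
  shows "((\<lambda>\<tau>. z \<tau> \<bullet> h) has_integral t * (cesaro t \<bullet> h)) {0..t}"
  using has_integral_linear[OF has_integral_cesaro[OF assms] bounded_linear_inner_left[of h]]
  by (simp add: o_def)

lemma energy_has_integral:
  assumes "0 \<le> s" "s \<le> t"
  shows "(energy' w has_integral energy w t - energy w s) {s..t}"
proof (rule fundamental_theorem_of_calculus[OF assms(2)])
  fix \<tau> assume \<tau>: "\<tau> \<in> {s..t}"
  define D where "D = (gradient f (fst (z \<tau>)) + adjoint A (snd (z \<tau>)), b - A (fst (z \<tau>)))"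
  have "(z has_vector_derivative - D) (at \<tau> within {s..t})"
    using flow[of \<tau>] \<tau> assms unfolding D_def by (auto intro: has_vector_derivative_within_subset)
  then have D: "((\<lambda>\<tau>. z \<tau> - w) has_derivative (\<lambda>h. h *\<^sub>R (- D))) (at \<tau> within {s..t})"
    unfolding has_vector_derivative_def using has_derivative_diff[OF _ has_derivative_const] by fastforce
  have "(energy w has_derivative
      (\<lambda>h. ((z \<tau> - w) \<bullet> (h *\<^sub>R (- D)) + (h *\<^sub>R (- D)) \<bullet> (z \<tau> - w)) / 2)) (at \<tau> within {s..t})"
    unfolding energy_def[abs_def]
    by (rule bounded_linear.has_derivative[OF bounded_linear_divide has_derivative_inner[OF D D]])
  moreover have "((z \<tau> - w) \<bullet> (h *\<^sub>R (- D)) + (h *\<^sub>R (- D)) \<bullet> (z \<tau> - w)) / 2 = h *\<^sub>R energy' w \<tau>" for h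
    unfolding energy'_def D_def[symmetric]
    by (simp add: inner_commute[of D] inner_diff_left field_simps)
  ultimately show "(energy w has_vector_derivative energy' w \<tau>) (at \<tau> within {s..t})"
    by (simp only: has_vector_derivative_def)
qed

text \<open>This is the tangent inequality at \<open>p = z t\<close> with \<open>q = w\<close>, where the gap of \<open>p\<close> with itself vanishes.\<close>

lemma energy'_le_gap: "energy' w t \<le> - gap (z t) w"
  using lagrangian_gap_above_tangent[OF convex differentiable linear, where p = "z t" and w = "z t" and q = w]
  by (simp add: energy'_def lagrangian_gap_swap[of _ _ _ w])

lemma energy_antimono:
  assumes "p \<in> saddle_points (Lagrangian f A b)" "0 \<le> s" "s \<le> t"
  shows "energy p t \<le> energy p s"
proof -
  have "energy' p \<tau> \<le> 0" for \<tau>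
    using energy'_le_gap[of p \<tau>] lagrangian_gap_saddle_point_nonneg[OF assms(1), of "z \<tau>"] by simp
  then have "energy p t - energy p s \<le> 0"
    using has_integral_le[OF energy_has_integral[OF assms(2,3)] has_integral_0] by blast
  then show ?thesis by simp
qed

text \<open>Jensen's inequality through a supporting affine function: the tangent at
  \<open>cesaro t\<close> lies below \<open>gap (z \<tau>) w\<close>, and its linear part integrates
  to zero because \<open>cesaro t\<close> is the mean of \<open>z\<close>.\<close>

lemma gap_cesaro_le:
  assumes "0 < t"
  shows "gap (cesaro t) w \<le> energy w 0 / t"
proof -
  let ?D = "(gradient f (fst (cesaro t)) + adjoint A (snd w), b - A (fst w))"
  have "((\<lambda>\<tau>. - gap (cesaro t) w + cesaro t \<bullet> ?D - z \<tau> \<bullet> ?D) has_integral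
      t * (- gap (cesaro t) w + cesaro t \<bullet> ?D) - t * (cesaro t \<bullet> ?D)) {0..t}"
    using has_integral_const_real[of "- gap (cesaro t) w + cesaro t \<bullet> ?D" 0 t] assms
    by (intro has_integral_diff has_integral_inner_cesaro) simp_all
  moreover have "energy' w \<tau> \<le> - gap (cesaro t) w + cesaro t \<bullet> ?D - z \<tau> \<bullet> ?D" for \<tau>
    using energy'_le_gap[of w \<tau>]
      lagrangian_gap_above_tangent[OF convex differentiable linear, where p = "cesaro t" and w = w and q = "z \<tau>" and b = b]
    unfolding inner_diff_left by linarith
  ultimately have "energy w t - energy w 0
      \<le> t * (- gap (cesaro t) w + cesaro t \<bullet> ?D) - t * (cesaro t \<bullet> ?D)"
    using has_integral_le[OF energy_has_integral] assms by (meson less_imp_le order_refl)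
  then have "t * gap (cesaro t) w \<le> energy w 0 - energy w t"
    unfolding distrib_left by linarith
  also have "\<dots> \<le> energy w 0" by (simp add: energy_def)
  finally show ?thesis using assms by (simp add: pos_le_divide_eq mult.commute)
qed

text \<open>The tangent at \<open>p\<close> replaces weak lower semicontinuity: it is affine, so it
  converges to \<open>gap p w\<close> under weak convergence, while staying below the vanishing
  \<open>energy w 0 / t\<close>.\<close>

lemma weak_cluster_point_is_saddle_point:
  assumes "G \<noteq> bot" "G \<le> at_top" and p: "weakly_tendsto cesaro p G"
  shows "p \<in> saddle_points (Lagrangian f A b)"
  unfolding saddle_points_iff_gap
proof
  fix w
  let ?D = "(gradient f (fst p) + adjoint A (snd w), b - A (fst w))"
  have "((\<lambda>t. gap p w + (cesaro t \<bullet> ?D - p \<bullet> ?D)) \<longlongrightarrow> gap p w + (p \<bullet> ?D - p \<bullet> ?D)) G"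
    by (intro tendsto_intros weakly_tendsto_inner p)
  moreover have "((\<lambda>t. energy w 0 / t) \<longlongrightarrow> 0) G"
    using tendsto_mono[OF assms(2) real_tendsto_divide_at_top[OF tendsto_const filterlim_ident]] .
  moreover have "\<forall>\<^sub>F t in G. gap p w + (cesaro t \<bullet> ?D - p \<bullet> ?D) \<le> energy w 0 / t"
    using filter_leD[OF assms(2) eventually_gt_at_top[of 0]]
  proof eventually_elim
    case (elim t)
    then show ?case
      using gap_cesaro_le[of t w]
        lagrangian_gap_above_tangent[OF convex differentiable linear, where p = p and w = w and q = "cesaro t" and b = b]
      unfolding inner_diff_left by linarith
  qed
  ultimately have "gap p w + (p \<bullet> ?D - p \<bullet> ?D) \<le> 0"
    by (intro tendsto_le[OF assms(1)])
  then show "gap p w \<le> 0" by simp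
qed

text \<open>Provides the boundedness for \<open>opial\<close>: the trajectory stays in a ball around
  \<open>p\<close>, and averaging keeps the resulting norm bound.\<close>

lemma norm_cesaro_le:
  assumes p: "p \<in> saddle_points (Lagrangian f A b)" and "0 < t"
  shows "norm (cesaro t) \<le> norm p + norm (z 0 - p)"
proof -
  have "norm (z \<tau>) \<le> norm p + norm (z 0 - p)" if "0 \<le> \<tau>" for \<tau>
  proof -
    have "norm (z \<tau> - p) \<le> norm (z 0 - p)"
      using energy_antimono[OF p order_refl that]
      by (simp add: energy_def norm_le)
    then show ?thesis using norm_triangle_sub[of "z \<tau>" p] by linarith
  qed
  then have "norm (t *\<^sub>R cesaro t) \<le> (norm p + norm (z 0 - p)) * (t - 0)"
    using has_integral_bound_real[OF _ finite.emptyI has_integral_cesaro[OF assms(2)]] assms(2)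
    by simp
  then show ?thesis using assms(2) by (simp add: mult.commute)
qed

lemma cesaro_inner_saddle_points_diff_tendsto:
  assumes p: "p \<in> saddle_points (Lagrangian f A b)" and q: "q \<in> saddle_points (Lagrangian f A b)"
  shows "\<exists>c. ((\<lambda>t. cesaro t \<bullet> (p - q)) \<longlongrightarrow> c) at_top"
proof -
  have "\<exists>L. (energy r \<longlongrightarrow> L) at_top" if "r \<in> saddle_points (Lagrangian f A b)" for r
    using antimono_bounded_below_tendsto_at_top[of 0 "energy r" 0] energy_antimono[OF that]
    by (metis energy_def inner_ge_zero divide_nonneg_pos zero_less_numeral)
  then obtain P Q where "(energy p \<longlongrightarrow> P) at_top" "(energy q \<longlongrightarrow> Q) at_top"
    using p q by blast
  \<comment> \<open>The terms quadratic in \<open>z t\<close> cancel in the difference of energies;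
    the added constant leaves exactly \<open>z t \<bullet> (p - q)\<close>.\<close>
  then have "((\<lambda>t. energy q t - energy p t + (p \<bullet> p - q \<bullet> q) / 2) \<longlongrightarrow> Q - P + (p \<bullet> p - q \<bullet> q) / 2) at_top"
    by (intro tendsto_intros)
  moreover have "energy q t - energy p t + (p \<bullet> p - q \<bullet> q) / 2 = z t \<bullet> (p - q)" for t
    by (simp add: energy_def inner_diff_left inner_diff_right inner_commute field_simps)
  ultimately have "((\<lambda>t. z t \<bullet> (p - q)) \<longlongrightarrow> Q - P + (p \<bullet> p - q \<bullet> q) / 2) at_top" by simp
  then have "((\<lambda>t. integral {0..t} (\<lambda>\<tau>. z \<tau> \<bullet> (p - q)) / t) \<longlongrightarrow> Q - P + (p \<bullet> p - q \<bullet> q) / 2) at_top"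
    by (intro cesaro_tendsto_at_top continuous_intros continuous_on_z)
  moreover have "\<forall>\<^sub>F t in at_top. integral {0..t} (\<lambda>\<tau>. z \<tau> \<bullet> (p - q)) / t = cesaro t \<bullet> (p - q)"
    using eventually_gt_at_top[of 0]
    by eventually_elim (simp add: integral_unique[OF has_integral_inner_cesaro])
  ultimately show ?thesis by (blast intro: Lim_transform_eventually)
qed

lemma cesaro_weakly_tendsto:
  assumes "saddle_points (Lagrangian f A b) \<noteq> {}"
  obtains p where "p \<in> saddle_points (Lagrangian f A b)" "weakly_tendsto cesaro p at_top"
proof -
  obtain p where p: "p \<in> saddle_points (Lagrangian f A b)" using assms by blast
  have "\<forall>\<^sub>F t in at_top. norm (cesaro t) \<le> norm p + norm (z 0 - p)"
    using eventually_gt_at_top[of 0] by eventually_elim (rule norm_cesaro_le[OF p])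
  then show ?thesis
    by (rule opial[OF trivial_limit_at_top_linorder _ weak_cluster_point_is_saddle_point
        cesaro_inner_saddle_points_diff_tendsto that])
qed

text \<open>Nonnegativity of the gap at a saddle point turns the one-sided bound of
  \<open>gap_cesaro_le\<close> into one on the absolute value.\<close>

lemma gap_cesaro_bigo:
  assumes "p \<in> saddle_points (Lagrangian f A b)"
  shows "(\<lambda>t. gap (cesaro t) p) \<in> O[at_top](\<lambda>t. 1 / t)"
proof (rule bigoI)
  show "\<forall>\<^sub>F t in at_top. norm (gap (cesaro t) p) \<le> energy p 0 * norm (1 / t)"
    using eventually_gt_at_top[of 0]
  proof eventually_elim
    case (elim t)
    have "0 \<le> gap (cesaro t) p"
      using assms by (rule lagrangian_gap_saddle_point_nonneg)
    then show ?case using gap_cesaro_le[OF elim, of p] elim by simp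
  qed
qed

end

section \<open>Transfer to solutions of (AH)\<close>

theorem proposition2p5:
  fixes f :: "'a::{real_inner, banach} \<Rightarrow> real"
    and A :: "'a \<Rightarrow> 'b::{real_inner, banach}"
    and b :: 'b
    and x0 :: 'a and l0 :: 'b
    and x :: "real \<Rightarrow> 'a" and l :: "real \<Rightarrow> 'b"
    and \<sigma> :: "real \<Rightarrow> 'a" and \<omega> :: "real \<Rightarrow> 'b"
  assumes "convex_on UNIV f"
    and "continuously_differentiable f"
    and "\<And>B. bounded B \<Longrightarrow> \<exists>C. C-lipschitz_on B (gradient f)"
    and "bounded_linear A"
    and "saddle_points (Lagrangian f A b) \<noteq> {}"
    and "AH_solution f A b x0 l0 x l"
    and "\<And>t. t > 0 \<Longrightarrow> (\<sigma> t, \<omega> t) = (1 / t) *\<^sub>R integral {0..t} (\<lambda>\<tau>. (x \<tau>, l \<tau>))"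
  shows "(\<forall>(\<xi>, \<eta>) \<in> saddle_points (Lagrangian f A b).
            (\<lambda>t. Lagrangian f A b (\<sigma> t) \<eta> - Lagrangian f A b \<xi> (\<omega> t)) \<in> O[at_top](\<lambda>t. 1 / t)) \<and>
         (\<exists>(xb, lb) \<in> saddle_points (Lagrangian f A b).
            weakly_tendsto (\<lambda>t. (\<sigma> t, \<omega> t)) (xb, lb) at_top)"
proof -
  define z where "z t = (x t, l t)" for t
  interpret AH_flow f A b z
  proof (rule AH_flow.intro)
    show "convex_on UNIV f" by fact
    show "bounded_linear A" by fact
    show "f differentiable at u" for u
      using assms(2) unfolding continuously_differentiable_def differentiable_def by blast
    fix t :: real assume t: "0 \<le> t"
    obtain x' l' where
      "(x has_vector_derivative x') (at t within {0..})"
      "(l has_vector_derivative l') (at t within {0..})"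
      and "x' + gradient f (x t) + adjoint A (l t) = 0" "l' + b - A (x t) = 0"
      using assms(6) t unfolding AH_solution_def by blast
    moreover from this(3,4) have "x' = - (gradient f (x t) + adjoint A (l t))" "l' = - (b - A (x t))"
      by (simp_all add: algebra_simps eq_neg_iff_add_eq_0)
    ultimately show "(z has_vector_derivative
        - (gradient f (fst (z t)) + adjoint A (snd (z t)), b - A (fst (z t)))) (at t within {0..})"
      unfolding z_def by (simp add: has_vector_derivative_Pair)
  qed
  \<comment> \<open>\<open>\<sigma>\<close> and \<open>\<omega>\<close> are prescribed only for
    \<open>t > 0\<close>; eventual equality suffices, as both conclusions concern
    \<open>at_top\<close>.\<close>
  have eq: "\<forall>\<^sub>F t in at_top. cesaro t = (\<sigma> t, \<omega> t)"
    using eventually_gt_at_top[of 0]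
    by eventually_elim (simp add: assms(7) cesaro_def flip: z_def)
  have "(\<lambda>t. Lagrangian f A b (\<sigma> t) \<eta> - Lagrangian f A b \<xi> (\<omega> t)) \<in> O[at_top](\<lambda>t. 1 / t)"
    if "(\<xi>, \<eta>) \<in> saddle_points (Lagrangian f A b)" for \<xi> \<eta>
  proof -
    have "\<forall>\<^sub>F t in at_top. gap (cesaro t) (\<xi>, \<eta>) = Lagrangian f A b (\<sigma> t) \<eta> - Lagrangian f A b \<xi> (\<omega> t)"
      using eq by eventually_elim (simp add: lagrangian_gap_def)
    then show ?thesis using gap_cesaro_bigo[OF that] by (simp cong: landau_o.big.in_cong)
  qed
  moreover obtain xb lb where "(xb, lb) \<in> saddle_points (Lagrangian f A b)"
    and lim: "weakly_tendsto cesaro (xb, lb) at_top"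
    using cesaro_weakly_tendsto[OF assms(5)] by (metis surj_pair)
  moreover have "weakly_tendsto (\<lambda>t. (\<sigma> t, \<omega> t)) (xb, lb) at_top"
    unfolding weakly_tendsto_def
  proof (intro allI impI)
    fix \<phi> :: "'a \<times> 'b \<Rightarrow> real" assume "bounded_linear \<phi>"
    then have "((\<lambda>t. \<phi> (cesaro t)) \<longlongrightarrow> \<phi> (xb, lb)) at_top"
      using lim by (simp add: weakly_tendsto_def)
    then show "((\<lambda>t. \<phi> (\<sigma> t, \<omega> t)) \<longlongrightarrow> \<phi> (xb, lb)) at_top"
      by (rule Lim_transform_eventually) (use eq in eventually_elim, simp)
  qed
  ultimately show ?thesis by blast
qed

end
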